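(* Let $f\in\mathbb{C}[t,\Delta_1,\ldots,\Delta_m]$. If $f$ is not suspicious, then $f$ is not guilty.
   Context: **Setting.** Fix positive integers $e_1,\ldots,e_m$ and polynomials $E_i=\Delta_i^{e_i}-g_i(t,\Delta_1,\ldots,\Delta_{i-1})\in\mathbb{C}[t,\Delta_1,\ldots,\Delta_m]$, $i=1,\ldots,m$, where $g_i$ is nonzero and $\deg_{\Delta_j}(g_i)<e_j$ for $j<i$ (these are the defining polynomials of the radicals $\delta_1,\ldots,\delta_m$ of a radical tower over $\mathbb{C}(t)$, with $\delta_i^{e_i}=g_i(t,\delta_1,\ldots,\delta_{i-1})$). **Weighted degree.** $\deg$ on $\mathbb{C}[t,\Delta_1,\ldots,\Delta_m]$ is the weighted degree with rational weights given by $\deg(t)=1$ and, recursively, $\deg(\Delta_i)=\deg(g_i)/e_i$ (and $\deg 0=-\infty$). **Suspicious.** Recursively, $f$ is suspicious when either (1) $f$ has at least two terms (monomials with nonzero coefficient) of highest weighted degree; or (2) for some $i$, $\Delta_i$ appears in the (only) leading term of $f$ and $g_i(t,\Delta_1,\ldots,\Delta_{i-1})$ is suspicious. **$R(f)$ and guilty.** Let $\gamma_k=\exp(2\pi \mathrm{i}/e_k)$. Put $f_m=f$ and recursively, for $k=m,\ldots,1$, $$F_k=\prod_{j=1}^{e_k} f_k(t,\Delta_1,\ldots,\Delta_{k-1},\gamma_k^j\Delta_k),\qquad f_{k-1}=\mathrm{rem}(F_k,E_k),$$ the remainder of the division of $F_k$ by $E_k$ with respect to $\Delta_k$; one has $f_{k-1}\in\mathbb{C}[t,\Delta_1,\ldots,\Delta_{k-1}]$.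 Set $R(f)=f_0\in\mathbb{C}[t]$. The polynomial $f$ is guilty when $\deg(f)\cdot e_1\cdots e_m>\deg(R(f))$. *)

theory Defs
  imports Complex_Main "HOL-Library.Poly_Mapping" "HOL-Library.Extended_Real"
begin

text \<open>
  A polynomial over the complex numbers maps monomials (finitely supported exponent vectors) to
  coefficients. Variable 0 is \<open>t\<close>, variable \<open>i \<ge> 1\<close> is \<open>\<Delta>\<^sub>i\<close>.
\<close>

type_synonym monomial = "nat \<Rightarrow>\<^sub>0 nat"
type_synonym mpoly = "monomial \<Rightarrow>\<^sub>0 complex"

definition Const :: "complex \<Rightarrow> mpoly" where
  "Const c = Poly_Mapping.single 0 c"

definition Var :: "nat \<Rightarrow> mpoly" where
  "Var i = Poly_Mapping.single (Poly_Mapping.single i 1) 1"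

text \<open>\<open>polys_in k\<close> is the polynomial ring in \<open>t, \<Delta>\<^sub>1, \<dots>, \<Delta>\<^sub>k\<close>.\<close>

definition polys_in :: "nat \<Rightarrow> mpoly set" where
  "polys_in k = {p. \<forall>\<mu>\<in>Poly_Mapping.keys p. Poly_Mapping.keys \<mu> \<subseteq> {..k}}"

definition subst :: "(nat \<Rightarrow> mpoly) \<Rightarrow> mpoly \<Rightarrow> mpoly" where
  "subst \<sigma> p =
     (\<Sum>\<mu>\<in>Poly_Mapping.keys p.
        Const (Poly_Mapping.lookup p \<mu>) * (\<Prod>i\<in>Poly_Mapping.keys \<mu>. \<sigma> i ^ Poly_Mapping.lookup \<mu> i))"

text \<open>Ordinary degree in variable \<open>k\<close>; here the zero polynomial gets degree 0.\<close>

definition degree_in :: "nat \<Rightarrow> mpoly \<Rightarrow> nat" where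
  "degree_in k p = Max (insert 0 ((\<lambda>\<mu>. Poly_Mapping.lookup \<mu> k) ` Poly_Mapping.keys p))"

text \<open>
  Only used for divisors \<open>E\<close> that are monic of positive degree in variable \<open>k\<close>, for which the
  remainder exists and is unique.
\<close>

definition rem_in :: "nat \<Rightarrow> mpoly \<Rightarrow> mpoly \<Rightarrow> mpoly" where
  "rem_in k F E = (THE r. degree_in k r < degree_in k E \<and> E dvd (F - r))"

definition monomial_weight :: "(nat \<Rightarrow> real) \<Rightarrow> monomial \<Rightarrow> real" where
  "monomial_weight w \<mu> = (\<Sum>i\<in>Poly_Mapping.keys \<mu>. real (Poly_Mapping.lookup \<mu> i) * w i)"

definition wdegree :: "(nat \<Rightarrow> real) \<Rightarrow> mpoly \<Rightarrow> ereal" where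
  "wdegree w p = (if p = 0 then -\<infinity> else ereal (Max (monomial_weight w ` Poly_Mapping.keys p)))"

text \<open>
  The weights \<open>deg t = 1\<close> and \<open>deg \<Delta>\<^sub>i = deg g\<^sub>i / e\<^sub>i\<close>. The guard \<open>j < i\<close> is there for termination only,
  since \<open>g\<^sub>i\<close> contains just variables below \<open>i\<close>. As \<open>g\<^sub>i\<close> is nonzero its degree is finite, so
  \<open>real_of_ereal\<close> loses nothing, and all weights are rational.
\<close>

fun weight :: "(nat \<Rightarrow> nat) \<Rightarrow> (nat \<Rightarrow> mpoly) \<Rightarrow> nat \<Rightarrow> real" where
  "weight e g i = (if i = 0 then 1
     else real_of_ereal (wdegree (\<lambda>j. if j < i then weight e g j else 0) (g i)) / real (e i))"

declare weight.simps [simp del]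

abbreviation wdeg :: "(nat \<Rightarrow> nat) \<Rightarrow> (nat \<Rightarrow> mpoly) \<Rightarrow> mpoly \<Rightarrow> ereal" where
  "wdeg e g \<equiv> wdegree (weight e g)"

definition leading_monomials :: "(nat \<Rightarrow> nat) \<Rightarrow> (nat \<Rightarrow> mpoly) \<Rightarrow> mpoly \<Rightarrow> monomial set" where
  "leading_monomials e g f =
     {\<mu> \<in> Poly_Mapping.keys f. ereal (monomial_weight (weight e g) \<mu>) = wdeg e g f}"

inductive suspicious :: "(nat \<Rightarrow> nat) \<Rightarrow> (nat \<Rightarrow> mpoly) \<Rightarrow> mpoly \<Rightarrow> bool"
  for e :: "nat \<Rightarrow> nat" and g :: "nat \<Rightarrow> mpoly" where
  several_leading_terms:
    "card (leading_monomials e g f) \<ge> 2 \<Longrightarrow> suspicious e g f"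
| suspicious_radicand:
    "leading_monomials e g f = {\<mu>} \<Longrightarrow> i \<ge> 1 \<Longrightarrow> i \<in> Poly_Mapping.keys \<mu> \<Longrightarrow> suspicious e g (g i)
     \<Longrightarrow> suspicious e g f"

definition E_poly :: "(nat \<Rightarrow> nat) \<Rightarrow> (nat \<Rightarrow> mpoly) \<Rightarrow> nat \<Rightarrow> mpoly" where
  "E_poly e g k = Var k ^ e k - g k"

definition root_of_1 :: "nat \<Rightarrow> complex" where
  "root_of_1 n = exp (2 * of_real pi * \<i> / of_nat n)"

definition conjugate_product :: "(nat \<Rightarrow> nat) \<Rightarrow> nat \<Rightarrow> mpoly \<Rightarrow> mpoly" where
  "conjugate_product e k f =
     (\<Prod>j=1..e k. subst (Var(k := Const (root_of_1 (e k) ^ j) * Var k)) f)"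

text \<open>\<open>R_poly e g m f\<close> eliminates \<open>\<Delta>\<^sub>m, \<dots>, \<Delta>\<^sub>1\<close> in this order.\<close>

primrec R_poly :: "(nat \<Rightarrow> nat) \<Rightarrow> (nat \<Rightarrow> mpoly) \<Rightarrow> nat \<Rightarrow> mpoly \<Rightarrow> mpoly" where
  "R_poly e g 0 f = f"
| "R_poly e g (Suc k) f =
     R_poly e g k (rem_in (Suc k) (conjugate_product e (Suc k) f) (E_poly e g (Suc k)))"

definition guilty :: "(nat \<Rightarrow> nat) \<Rightarrow> (nat \<Rightarrow> mpoly) \<Rightarrow> nat \<Rightarrow> mpoly \<Rightarrow> bool" where
  "guilty e g m f \<longleftrightarrow> wdeg e g f * ereal (real (\<Prod>i=1..m. e i)) > wdeg e g (R_poly e g m f)"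

end

theory Submission
  imports Defs "HOL-Analysis.Complex_Transcendental"
begin

text \<open>
  When \<open>f\<close> is not suspicious, its unique leading monomial \<open>\<mu>\<close> can be followed through the
  elimination. The product of the conjugates in \<open>\<Delta>\<^sub>k\<close> has the unique leading monomial \<open>\<mu>\<^bsup>e\<^sub>k\<^esup>\<close>, and it
  is invariant under \<open>\<Delta>\<^sub>k \<mapsto> \<gamma>\<^sub>k \<Delta>\<^sub>k\<close>, hence a polynomial in \<open>\<Delta>\<^sub>k\<^bsup>e\<^sub>k\<^esup>\<close>. Its remainder therefore arises
  by substituting \<open>g\<^sub>k\<close> for \<open>\<Delta>\<^sub>k\<^bsup>e\<^sub>k\<^esup>\<close>. By the choice of the weights this preserves the weight of each
  monomial up to terms of lower weight, and if \<open>\<Delta>\<^sub>k\<close> occurs in \<open>\<mu>\<close>, then \<open>g\<^sub>k\<close> itself has a unique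
  leading monomial. So the degree is multiplied by exactly \<open>e\<^sub>k\<close> in each step.
\<close>

subsection \<open>Products of finitely supported functions\<close>

text \<open>General in both types, because it splits polynomials into terms as well as exponent
  vectors into multiples of unit vectors.\<close>

lemma sum_single_keys:
  fixes p :: "'a \<Rightarrow>\<^sub>0 'b::comm_monoid_add"
  assumes "finite A" "Poly_Mapping.keys p \<subseteq> A"
  shows "(\<Sum>a\<in>A. Poly_Mapping.single a (Poly_Mapping.lookup p a)) = p"
proof (rule poly_mapping_eqI)
  fix x
  have "Poly_Mapping.lookup (\<Sum>a\<in>A. Poly_Mapping.single a (Poly_Mapping.lookup p a)) x
      = (\<Sum>a\<in>A. if a = x then Poly_Mapping.lookup p a else 0)"
    by (simp add: lookup_sum lookup_single when_def)
  also have "\<dots> = Poly_Mapping.lookup p x"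
    using assms by (auto simp: in_keys_iff)
  finally show "Poly_Mapping.lookup (\<Sum>a\<in>A. Poly_Mapping.single a (Poly_Mapping.lookup p a)) x
      = Poly_Mapping.lookup p x" .
qed

text \<open>The convolution formula. Supersets \<open>A\<close>, \<open>B\<close> of the supports
  allow a product of rescaled polynomials to be summed over the supports of the original
  ones.\<close>

lemma lookup_mult_sum:
  fixes p q :: mpoly
  assumes "finite A" "Poly_Mapping.keys p \<subseteq> A" "finite B" "Poly_Mapping.keys q \<subseteq> B"
  shows "Poly_Mapping.lookup (p * q) \<mu> = (\<Sum>a\<in>A. \<Sum>b\<in>B.
    if a + b = \<mu> then Poly_Mapping.lookup p a * Poly_Mapping.lookup q b else 0)"
proof -
  have "p * q = (\<Sum>a\<in>A. Poly_Mapping.single a (Poly_Mapping.lookup p a))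
      * (\<Sum>b\<in>B. Poly_Mapping.single b (Poly_Mapping.lookup q b))"
    using assms by (simp add: sum_single_keys)
  also have "\<dots> = (\<Sum>a\<in>A. \<Sum>b\<in>B.
      Poly_Mapping.single (a + b) (Poly_Mapping.lookup p a * Poly_Mapping.lookup q b))"
    by (simp add: sum_product mult_single)
  finally show ?thesis
    by (simp add: lookup_sum lookup_single when_def)
qed

text \<open>When only one pair of monomials contributes to \<mu> + \<nu>, nothing can cancel
  there.\<close>

lemma lookup_mult_unique:
  fixes p q :: mpoly
  assumes "\<mu> \<in> Poly_Mapping.keys p" "\<nu> \<in> Poly_Mapping.keys q"
    and "\<And>a b. a \<in> Poly_Mapping.keys p \<Longrightarrow> b \<in> Poly_Mapping.keys q \<Longrightarrow> a + b = \<mu> + \<nu>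
      \<Longrightarrow> a = \<mu> \<and> b = \<nu>"
  shows "Poly_Mapping.lookup (p * q) (\<mu> + \<nu>) = Poly_Mapping.lookup p \<mu> * Poly_Mapping.lookup q \<nu>"
proof -
  have "Poly_Mapping.lookup (p * q) (\<mu> + \<nu>)
      = (\<Sum>a\<in>Poly_Mapping.keys p. \<Sum>b\<in>Poly_Mapping.keys q.
          if a + b = \<mu> + \<nu> then Poly_Mapping.lookup p a * Poly_Mapping.lookup q b else 0)"
    by (rule lookup_mult_sum) auto
  also have "\<dots> = (\<Sum>a\<in>Poly_Mapping.keys p. \<Sum>b\<in>Poly_Mapping.keys q.
      if b = \<nu> then (if a = \<mu> then Poly_Mapping.lookup p a * Poly_Mapping.lookup q b else 0) else 0)"
    using assms(3) by (intro sum.cong refl) auto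
  also have "\<dots> = Poly_Mapping.lookup p \<mu> * Poly_Mapping.lookup q \<nu>"
    using assms(1,2) by simp
  finally show ?thesis .
qed

lemma in_keys_multE:
  fixes p q :: mpoly
  assumes "\<mu> \<in> Poly_Mapping.keys (p * q)"
  obtains a b where "a \<in> Poly_Mapping.keys p" "b \<in> Poly_Mapping.keys q" "\<mu> = a + b"
  using keys_mult[of p q] assms by blast

lemma in_keys_sumE:
  fixes p :: "'i \<Rightarrow> mpoly"
  assumes "\<mu> \<in> Poly_Mapping.keys (sum p I)"
  obtains i where "i \<in> I" "\<mu> \<in> Poly_Mapping.keys (p i)"
  using keys_sum[of p I] assms by blast

text \<open>Exponents are natural numbers and never cancel.\<close>

lemma keys_add_nat:
  fixes \<mu> \<nu> :: monomial
  shows "Poly_Mapping.keys (\<mu> + \<nu>) = Poly_Mapping.keys \<mu> \<union> Poly_Mapping.keys \<nu>"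
  by (auto simp: in_keys_iff lookup_add)

section \<open>Closure of the rings \<open>polys_in k\<close>\<close>

lemma polys_in_mult:
  assumes "p \<in> polys_in k" "q \<in> polys_in k"
  shows "p * q \<in> polys_in k"
  unfolding polys_in_def
proof (safe elim!: in_keys_multE)
  fix a b x assume "a \<in> Poly_Mapping.keys p" "b \<in> Poly_Mapping.keys q"
    "x \<in> Poly_Mapping.keys (a + b)"
  then show "x \<le> k" using assms by (fastforce simp: polys_in_def keys_add_nat)
qed

lemma polys_in_1: "1 \<in> polys_in k"
  by (simp add: polys_in_def)

lemma polys_in_prod:
  assumes "\<And>j. j \<in> J \<Longrightarrow> p j \<in> polys_in k"
  shows "prod p J \<in> polys_in k"
  using assms by (induction J rule: infinite_finite_induct) (simp_all add: polys_in_mult polys_in_1)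

lemma polys_in_power: "p \<in> polys_in k \<Longrightarrow> p ^ n \<in> polys_in k"
  by (induction n) (simp_all add: polys_in_mult polys_in_1)

lemma polys_in_sum:
  assumes "\<And>j. j \<in> J \<Longrightarrow> p j \<in> polys_in k"
  shows "sum p J \<in> polys_in k"
  using assms unfolding polys_in_def by (blast elim: in_keys_sumE)

subsection \<open>Unique leading monomials\<close>

lemma monomial_weight_superset:
  assumes "finite A" "Poly_Mapping.keys \<mu> \<subseteq> A"
  shows "monomial_weight w \<mu> = (\<Sum>i\<in>A. real (Poly_Mapping.lookup \<mu> i) * w i)"
  unfolding monomial_weight_def
  using assms by (intro sum.mono_neutral_left) (auto simp: in_keys_iff)

lemma monomial_weight_add: "monomial_weight w (\<mu> + \<nu>) = monomial_weight w \<mu> + monomial_weight w \<nu>"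
proof -
  let ?A = "Poly_Mapping.keys \<mu> \<union> Poly_Mapping.keys \<nu>"
  show ?thesis
    using monomial_weight_superset[of ?A \<mu> w] monomial_weight_superset[of ?A \<nu> w]
      monomial_weight_superset[of ?A "\<mu> + \<nu>" w]
    by (simp add: keys_add_nat lookup_add sum.distrib algebra_simps)
qed

lemma monomial_weight_0 [simp]: "monomial_weight w 0 = 0"
  by (simp add: monomial_weight_def)

lemma monomial_weight_single [simp]: "monomial_weight w (Poly_Mapping.single k n) = real n * w k"
  by (simp add: monomial_weight_def)

text \<open>Distinct monomials may share a weight, so uniqueness at the top is a genuine condition
  on \<open>p\<close>. This is the property carried through the elimination, phrased with real
  weights to stay clear of extended reals.\<close>

definition strict_leading :: "(nat \<Rightarrow> real) \<Rightarrow> mpoly \<Rightarrow> monomial \<Rightarrow> bool" where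
  "strict_leading w p \<mu> \<longleftrightarrow> \<mu> \<in> Poly_Mapping.keys p \<and>
     (\<forall>\<nu>\<in>Poly_Mapping.keys p. \<nu> \<noteq> \<mu> \<longrightarrow> monomial_weight w \<nu> < monomial_weight w \<mu>)"

lemma strict_leadingI:
  assumes "\<mu> \<in> Poly_Mapping.keys p"
    and "\<And>\<nu>. \<nu> \<in> Poly_Mapping.keys p \<Longrightarrow> \<nu> \<noteq> \<mu> \<Longrightarrow> monomial_weight w \<nu> < monomial_weight w \<mu>"
  shows "strict_leading w p \<mu>"
  using assms by (simp add: strict_leading_def)

lemma strict_leading_keys: "strict_leading w p \<mu> \<Longrightarrow> \<mu> \<in> Poly_Mapping.keys p"
  by (simp add: strict_leading_def)

lemma strict_leading_le:
  "strict_leading w p \<mu> \<Longrightarrow> \<nu> \<in> Poly_Mapping.keys p \<Longrightarrow> monomial_weight w \<nu> \<le> monomial_weight w \<mu>"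
  unfolding strict_leading_def by force

lemma strict_leading_less:
  "strict_leading w p \<mu> \<Longrightarrow> \<nu> \<in> Poly_Mapping.keys p \<Longrightarrow> \<nu> \<noteq> \<mu>
   \<Longrightarrow> monomial_weight w \<nu> < monomial_weight w \<mu>"
  by (simp add: strict_leading_def)

text \<open>Every other pair of monomials has a strictly smaller total weight, so the product of the
  two leading coefficients survives as the coefficient of \<mu> + \<nu>.\<close>

lemma strict_leading_mult:
  assumes p: "strict_leading w p \<mu>" and q: "strict_leading w q \<nu>"
  shows "strict_leading w (p * q) (\<mu> + \<nu>)"
proof -
  have less: "monomial_weight w (a + b) < monomial_weight w (\<mu> + \<nu>)"
    if "a \<in> Poly_Mapping.keys p" "b \<in> Poly_Mapping.keys q" "\<not> (a = \<mu> \<and> b = \<nu>)" for a b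
    using that strict_leading_le[OF p, of a] strict_leading_le[OF q, of b]
      strict_leading_less[OF p, of a] strict_leading_less[OF q, of b]
    unfolding monomial_weight_add by fastforce
  show ?thesis
  proof (rule strict_leadingI)
    have "Poly_Mapping.lookup (p * q) (\<mu> + \<nu>) = Poly_Mapping.lookup p \<mu> * Poly_Mapping.lookup q \<nu>"
      using p q by (intro lookup_mult_unique) (auto simp: strict_leading_def dest: less)
    then show "\<mu> + \<nu> \<in> Poly_Mapping.keys (p * q)"
      using p q by (simp add: strict_leading_def in_keys_iff)
  next
    fix \<kappa> assume "\<kappa> \<in> Poly_Mapping.keys (p * q)" "\<kappa> \<noteq> \<mu> + \<nu>"
    then show "monomial_weight w \<kappa> < monomial_weight w (\<mu> + \<nu>)"
      using less by (metis in_keys_multE)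
  qed
qed

lemma strict_leading_single:
  "c \<noteq> 0 \<Longrightarrow> strict_leading w (Poly_Mapping.single \<mu> c) \<mu>"
  by (simp add: strict_leading_def)

text \<open>The monomial \<nu> is \<mu> multiplied by \<open>card J\<close>; the elimination uses
  its weight and its variables. Their inclusion can be proper, as the empty product has leading
  monomial 0.\<close>

lemma strict_leading_prod:
  assumes "finite J" "\<And>j. j \<in> J \<Longrightarrow> strict_leading w (p j) \<mu>"
  obtains \<nu> where "strict_leading w (prod p J) \<nu>"
    "monomial_weight w \<nu> = real (card J) * monomial_weight w \<mu>"
    "Poly_Mapping.keys \<nu> \<subseteq> Poly_Mapping.keys \<mu>"
proof -
  have "\<exists>\<nu>. strict_leading w (prod p J) \<nu> \<and>
    monomial_weight w \<nu> = real (card J) * monomial_weight w \<mu> \<and>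
    Poly_Mapping.keys \<nu> \<subseteq> Poly_Mapping.keys \<mu>"
    using assms
  proof (induction J rule: finite_induct)
    case empty
    show ?case by (intro exI[of _ 0]) (simp add: strict_leading_def)
  next
    case (insert j J)
    then obtain \<nu> where "strict_leading w (prod p J) \<nu>"
      "monomial_weight w \<nu> = real (card J) * monomial_weight w \<mu>"
      "Poly_Mapping.keys \<nu> \<subseteq> Poly_Mapping.keys \<mu>" by auto
    with insert show ?case
      by (intro exI[of _ "\<mu> + \<nu>"])
        (auto simp: strict_leading_mult monomial_weight_add keys_add_nat algebra_simps)
  qed
  then show thesis using that by blast
qed

lemma strict_leading_power:
  assumes "strict_leading w p \<mu>"
  obtains \<nu> where "strict_leading w (p ^ n) \<nu>"
    "monomial_weight w \<nu> = real n * monomial_weight w \<mu>"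
    "Poly_Mapping.keys \<nu> \<subseteq> Poly_Mapping.keys \<mu>"
  using assms strict_leading_prod[of "{..<n}" w "\<lambda>_. p" \<mu>] by auto

text \<open>Each monomial of the power is a sum of \<open>n\<close> monomials of \<open>p\<close>.
  The bound also covers radicands with several monomials of top weight.\<close>

lemma monomial_weight_power_le:
  fixes p :: mpoly
  assumes "\<And>\<kappa>. \<kappa> \<in> Poly_Mapping.keys p \<Longrightarrow> monomial_weight w \<kappa> \<le> W"
    and "\<nu> \<in> Poly_Mapping.keys (p ^ n)"
  shows "monomial_weight w \<nu> \<le> real n * W"
  using assms(2)
proof (induction n arbitrary: \<nu>)
  case (Suc n)
  then obtain a b where "a \<in> Poly_Mapping.keys p" "b \<in> Poly_Mapping.keys (p ^ n)" "\<nu> = a + b"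
    by (auto elim: in_keys_multE)
  with Suc.IH[of b] assms(1)[of a] show ?case
    by (simp add: monomial_weight_add algebra_simps)
qed simp

text \<open>The summand \<open>p i\<close> dominates: no other one contains \<mu>, whose coefficient
  therefore survives.\<close>

lemma strict_leading_sum:
  assumes "finite I" "i \<in> I" and lead: "strict_leading w (p i) \<mu>"
    and other: "\<And>j \<nu>. j \<in> I \<Longrightarrow> j \<noteq> i \<Longrightarrow> \<nu> \<in> Poly_Mapping.keys (p j)
      \<Longrightarrow> monomial_weight w \<nu> < monomial_weight w \<mu>"
  shows "strict_leading w (sum p I) \<mu>"
proof (rule strict_leadingI)
  have "Poly_Mapping.lookup (p j) \<mu> = 0" if "j \<in> I - {i}" for j
    using other[of j \<mu>] that by (auto simp: in_keys_iff)
  then have "(\<Sum>j\<in>I - {i}. Poly_Mapping.lookup (p j) \<mu>) = 0"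
    by simp
  then have "Poly_Mapping.lookup (sum p I) \<mu> = Poly_Mapping.lookup (p i) \<mu>"
    unfolding lookup_sum using assms(1,2) by (simp add: sum.remove[of I i])
  then show "\<mu> \<in> Poly_Mapping.keys (sum p I)"
    using lead by (simp add: strict_leading_def in_keys_iff)
next
  fix \<nu> assume "\<nu> \<in> Poly_Mapping.keys (sum p I)" "\<nu> \<noteq> \<mu>"
  then show "monomial_weight w \<nu> < monomial_weight w \<mu>"
    using other strict_leading_less[OF lead] by (metis in_keys_sumE)
qed

lemma wdegree_strict_leading:
  assumes "strict_leading w p \<mu>"
  shows "wdegree w p = ereal (monomial_weight w \<mu>)"
proof -
  have "p \<noteq> 0" using assms by (auto simp: strict_leading_def)
  moreover have "Max (monomial_weight w ` Poly_Mapping.keys p) = monomial_weight w \<mu>"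
    using assms by (intro Max_eqI) (auto intro: strict_leading_le strict_leading_keys)
  ultimately show ?thesis by (simp add: wdegree_def)
qed

subsection \<open>The conjugate product\<close>

lemma prod_single:
  fixes c :: "'i \<Rightarrow> complex" and \<mu> :: "'i \<Rightarrow> monomial"
  shows "(\<Prod>i\<in>I. Poly_Mapping.single (\<mu> i) (c i)) = Poly_Mapping.single (\<Sum>i\<in>I. \<mu> i) (\<Prod>i\<in>I. c i)"
  by (induction I rule: infinite_finite_induct) (simp_all add: mult_single)

lemma power_single:
  fixes c :: complex
  shows "Poly_Mapping.single (Poly_Mapping.single i (a::nat)) c ^ n
    = Poly_Mapping.single (Poly_Mapping.single i (a * n)) (c ^ n)"
  by (induction n) (simp_all add: mult_single single_add [symmetric] algebra_simps)

definition scale_var :: "nat \<Rightarrow> complex \<Rightarrow> mpoly \<Rightarrow> mpoly" where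
  "scale_var k c = subst (Var(k := Const c * Var k))"

lemma conjugate_product_scale_var:
  "conjugate_product e k p = (\<Prod>j=1..e k. scale_var k (root_of_1 (e k) ^ j) p)"
  by (simp add: conjugate_product_def scale_var_def)

text \<open>Scaling a variable acts diagonally on monomials. The properties of
  \<open>scale_var\<close> below are read off from this formula.\<close>

lemma lookup_scale_var:
  "Poly_Mapping.lookup (scale_var k c p) \<mu>
    = Poly_Mapping.lookup p \<mu> * c ^ Poly_Mapping.lookup \<mu> k"
proof -
  have mono: "Const a * (\<Prod>i\<in>Poly_Mapping.keys \<nu>. (Var(k := Const c * Var k)) i ^ Poly_Mapping.lookup \<nu> i)
      = Poly_Mapping.single \<nu> (a * c ^ Poly_Mapping.lookup \<nu> k)" for a \<nu>
  proof -
    have "(Var(k := Const c * Var k)) i ^ Poly_Mapping.lookup \<nu> i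
        = Poly_Mapping.single (Poly_Mapping.single i (Poly_Mapping.lookup \<nu> i))
            (if i = k then c ^ Poly_Mapping.lookup \<nu> k else 1)" for i
      by (simp add: Var_def Const_def mult_single power_single)
    then have "(\<Prod>i\<in>Poly_Mapping.keys \<nu>. (Var(k := Const c * Var k)) i ^ Poly_Mapping.lookup \<nu> i)
        = Poly_Mapping.single \<nu>
            (\<Prod>i\<in>Poly_Mapping.keys \<nu>. if i = k then c ^ Poly_Mapping.lookup \<nu> k else 1)"
      by (simp add: prod_single sum_single_keys del: fun_upd_apply)
    \<comment> \<open>If \<open>k\<close> does not occur in \<nu>, the product is 1, and so is the
      right side, where the exponent is 0.\<close>
    also have "(\<Prod>i\<in>Poly_Mapping.keys \<nu>. if i = k then c ^ Poly_Mapping.lookup \<nu> k else 1)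
        = c ^ Poly_Mapping.lookup \<nu> k"
      by (simp add: in_keys_iff)
    finally show ?thesis by (simp add: Const_def mult_single)
  qed
  show ?thesis
    unfolding scale_var_def subst_def mono
    by (simp add: lookup_sum lookup_single when_def in_keys_iff)
qed

text \<open>The exponent of variable \<open>k\<close> is additive in monomials, so the scaling
  factors multiply inside the convolution formula.\<close>

lemma scale_var_mult:
  "scale_var k c (p * q)
    = scale_var k c p * scale_var k c q"
    (is "?S (p * q) = ?S p * ?S q")
proof (rule poly_mapping_eqI)
  fix \<mu>
  have keys: "Poly_Mapping.keys (?S r) \<subseteq> Poly_Mapping.keys r" for r
    by (auto simp: in_keys_iff lookup_scale_var)
  let ?A = "Poly_Mapping.keys p" and ?B = "Poly_Mapping.keys q"
  have "Poly_Mapping.lookup (?S p * ?S q) \<mu> = (\<Sum>a\<in>?A. \<Sum>b\<in>?B. if a + b = \<mu>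
      then Poly_Mapping.lookup (?S p) a * Poly_Mapping.lookup (?S q) b else 0)"
    by (rule lookup_mult_sum) (auto dest: subsetD[OF keys])
  also have "\<dots> = (\<Sum>a\<in>?A. \<Sum>b\<in>?B. if a + b = \<mu>
      then Poly_Mapping.lookup p a * Poly_Mapping.lookup q b else 0) * c ^ Poly_Mapping.lookup \<mu> k"
    unfolding sum_distrib_right
    by (intro sum.cong refl) (auto simp: lookup_scale_var lookup_add power_add)
  also have "\<dots> = Poly_Mapping.lookup (?S (p * q)) \<mu>"
    by (simp add: lookup_scale_var lookup_mult_sum[of ?A p ?B q])
  finally show "Poly_Mapping.lookup (?S (p * q)) \<mu> = Poly_Mapping.lookup (?S p * ?S q) \<mu>" ..
qed

lemma scale_var_prod:
  assumes "finite J"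
  shows "scale_var k c (prod p J)
    = (\<Prod>j\<in>J. scale_var k c (p j))"
  using assms
proof (induction J rule: finite_induct)
  case empty
  have "scale_var k c 1 = 1"
    by (rule poly_mapping_eqI) (auto simp: lookup_scale_var lookup_one when_def)
  then show ?case by simp
qed (simp add: scale_var_mult)

lemma scale_var_scale_var:
  "scale_var k c (scale_var k d p)
    = scale_var k (c * d) p"
  by (rule poly_mapping_eqI) (simp add: lookup_scale_var power_mult_distrib)

lemma strict_leading_scale_var:
  assumes "strict_leading w p \<mu>" "c \<noteq> 0"
  shows "strict_leading w (scale_var k c p) \<mu>"
  using assms by (simp add: strict_leading_def in_keys_iff lookup_scale_var)

lemma polys_in_scale_var:
  "p \<in> polys_in n \<Longrightarrow> scale_var k c p \<in> polys_in n"
  by (simp add: polys_in_def in_keys_iff lookup_scale_var)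

text \<open>The root is primitive, which is what later turns invariance into divisibility of
  exponents.\<close>

lemma root_of_1_power_eq_1_iff:
  assumes "n > 0"
  shows "root_of_1 n ^ j = 1 \<longleftrightarrow> n dvd j"
proof -
  have "root_of_1 n ^ j = exp (2 * of_real pi * \<i> * of_nat j / of_nat n)"
    unfolding root_of_1_def exp_of_nat_mult [symmetric] by (simp add: algebra_simps)
  then show ?thesis using complex_root_unity_eq_1[of n j] assms by simp
qed

lemma root_of_1_nonzero: "root_of_1 n \<noteq> 0"
  by (simp add: root_of_1_def)

text \<open>Scaling variable \<open>k\<close> by the root of unity permutes the conjugates
  cyclically and so fixes their product. Each monomial that occurs must then be fixed as
  well.\<close>

lemma dvd_lookup_conjugate_product:
  assumes "e k > 0" "\<mu> \<in> Poly_Mapping.keys (conjugate_product e k p)"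
  shows "e k dvd Poly_Mapping.lookup \<mu> k"
proof -
  let ?\<gamma> = "root_of_1 (e k)" and ?F = "conjugate_product e k p"
  let ?h = "\<lambda>j. scale_var k (?\<gamma> ^ j) p"
  have "scale_var k ?\<gamma> ?F = (\<Prod>j=1..e k. ?h (Suc j))"
    unfolding conjugate_product_scale_var by (simp add: scale_var_prod scale_var_scale_var)
  also have "\<dots> = prod ?h {Suc 1..Suc (e k)}"
    by (rule prod.shift_bounds_cl_Suc_ivl [symmetric])
  also have "\<dots> = ?h (Suc (e k)) * prod ?h {Suc 1..e k}"
    using assms(1) by (intro prod.nat_ivl_Suc') simp
  \<comment> \<open>The cycle closes: the factor shifted beyond the range is the first one
    again.\<close>
  also have "?h (Suc (e k)) = ?h 1"
    using root_of_1_power_eq_1_iff[OF assms(1), of "e k"] by simp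
  also have "?h 1 * prod ?h {Suc 1..e k} = prod ?h {1..e k}"
    using assms(1) by (intro prod.atLeast_Suc_atMost [symmetric]) simp
  also have "\<dots> = ?F"
    by (rule conjugate_product_scale_var [symmetric])
  finally have "Poly_Mapping.lookup ?F \<mu> * ?\<gamma> ^ Poly_Mapping.lookup \<mu> k = Poly_Mapping.lookup ?F \<mu>"
    using lookup_scale_var[of k ?\<gamma> ?F \<mu>] by simp
  \<comment> \<open>The coefficient is nonzero; cancelling it leaves a power of the root equal to
    1.\<close>
  then show ?thesis
    using assms root_of_1_power_eq_1_iff by (simp add: in_keys_iff)
qed

subsection \<open>The remainder\<close>

lemma lookup_le_degree_in: "\<mu> \<in> Poly_Mapping.keys p \<Longrightarrow> Poly_Mapping.lookup \<mu> k \<le> degree_in k p"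
  unfolding degree_in_def by (intro Max_ge) auto

lemma degree_in_leI:
  assumes "\<And>\<mu>. \<mu> \<in> Poly_Mapping.keys p \<Longrightarrow> Poly_Mapping.lookup \<mu> k \<le> n"
  shows "degree_in k p \<le> n"
  unfolding degree_in_def using assms by (subst Max_le_iff) auto

lemma degree_in_diff_less:
  assumes "degree_in k p < n" "degree_in k q < n"
  shows "degree_in k (p - q) < n"
proof -
  have "degree_in k (p - q) \<le> max (degree_in k p) (degree_in k q)"
  proof (rule degree_in_leI)
    fix \<mu> assume "\<mu> \<in> Poly_Mapping.keys (p - q)"
    then have "\<mu> \<in> Poly_Mapping.keys p \<or> \<mu> \<in> Poly_Mapping.keys q"
      by (auto simp: in_keys_iff lookup_minus)
    then show "Poly_Mapping.lookup \<mu> k \<le> max (degree_in k p) (degree_in k q)"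
      using lookup_le_degree_in[of \<mu> p k] lookup_le_degree_in[of \<mu> q k] by auto
  qed
  with assms show ?thesis by linarith
qed

lemma Var_power: "Var k ^ n = Poly_Mapping.single (Poly_Mapping.single k n) 1"
  by (simp add: Var_def power_single)

text \<open>The divisor is monic of degree \<open>n\<close> in variable \<open>k\<close>. Shifting a
  monomial of \<open>q\<close> of maximal exponent in \<open>k\<close> by \<open>n\<close> yields
  one that the terms of \<open>G * q\<close> cannot reach.\<close>

lemma degree_in_monic_mult:
  fixes G q :: mpoly
  assumes "n > 0" and G: "\<And>\<nu>. \<nu> \<in> Poly_Mapping.keys G \<Longrightarrow> Poly_Mapping.lookup \<nu> k = 0"
    and "q \<noteq> 0"
  shows "n \<le> degree_in k ((Var k ^ n - G) * q)"
proof -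
  let ?d = "\<lambda>\<mu>. Poly_Mapping.lookup \<mu> k" and ?s = "Poly_Mapping.single k n"
  have "finite (Poly_Mapping.keys q)" "Poly_Mapping.keys q \<noteq> {}" using assms(3) by auto
  then obtain \<mu> where \<mu>: "\<mu> \<in> Poly_Mapping.keys q"
    and max: "\<And>\<nu>. \<nu> \<in> Poly_Mapping.keys q \<Longrightarrow> ?d \<nu> \<le> ?d \<mu>"
    using Max_in[of "?d ` Poly_Mapping.keys q"] Max_ge[of "?d ` Poly_Mapping.keys q"] by fastforce
  have "Poly_Mapping.lookup (Var k ^ n * q) (?s + \<mu>) = 1 * Poly_Mapping.lookup q \<mu>"
    unfolding Var_power using \<mu> by (subst lookup_mult_unique) auto
  moreover have "?s + \<mu> \<notin> Poly_Mapping.keys (G * q)"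
  proof
    assume "?s + \<mu> \<in> Poly_Mapping.keys (G * q)"
    then obtain a b where "a \<in> Poly_Mapping.keys G" "b \<in> Poly_Mapping.keys q" "?s + \<mu> = a + b"
      by (rule in_keys_multE)
    then have "n + ?d \<mu> = ?d b" "?d b \<le> ?d \<mu>"
      using G max by (metis add_0 lookup_add lookup_single_eq, blast)
    with \<open>n > 0\<close> show False by simp
  qed
  ultimately have "?s + \<mu> \<in> Poly_Mapping.keys ((Var k ^ n - G) * q)"
    using \<mu> by (simp add: in_keys_iff algebra_simps lookup_minus)
  from lookup_le_degree_in[OF this, of k] show ?thesis by (simp add: lookup_add)
qed

text \<open>Two candidates differ by a multiple of the divisor of degree below \<open>n\<close>,
  which must be zero; hence the description in \<open>rem_in\<close> is unique.\<close>

lemma rem_in_eqI: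
  fixes F G r :: mpoly
  assumes "n > 0" and G: "\<And>\<nu>. \<nu> \<in> Poly_Mapping.keys G \<Longrightarrow> Poly_Mapping.lookup \<nu> k = 0"
    and r: "degree_in k r < n" "(Var k ^ n - G) dvd (F - r)"
  shows "rem_in k F (Var k ^ n - G) = r"
proof -
  \<comment> \<open>The cofactor 1 gives the lower bound for the degree of the divisor
    itself.\<close>
  have "n \<le> degree_in k (Var k ^ n - G)"
    using degree_in_monic_mult[of n G k 1] assms(1) G by simp
  moreover have "degree_in k (Var k ^ n - G) \<le> n"
    by (rule degree_in_leI)
      (use G in \<open>force simp: in_keys_iff lookup_minus Var_power lookup_single when_def split: if_splits\<close>)
  ultimately have deg: "degree_in k (Var k ^ n - G) = n" by simp
  show ?thesis
    unfolding rem_in_def deg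
  proof (rule the_equality)
    fix s assume s: "degree_in k s < n \<and> (Var k ^ n - G) dvd (F - s)"
    have "(Var k ^ n - G) dvd (F - r) - (F - s)" using s r(2) by (meson dvd_diff)
    then obtain q where q: "s - r = (Var k ^ n - G) * q" by (auto simp: dvd_def)
    have "degree_in k (s - r) < n" using s r by (simp add: degree_in_diff_less)
    with q degree_in_monic_mult[of n G k q] assms(1) G have "q = 0" by fastforce
    with q show "s = r" by simp
  qed (use r in simp)
qed

section \<open>Replacing a power of a variable by a polynomial\<close>

lemma diff_dvd_power_diff: "(x - y :: 'a::comm_ring_1) dvd x ^ n - y ^ n"
  by (simp add: power_diff_sumr2)

text \<open>Substitutes \<open>G\<close> for \<open>Var k ^ n\<close> when \<open>F\<close> is a
  polynomial in \<open>Var k ^ n\<close>; the division by \<open>n\<close> is then exact.\<close>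

definition replace_power :: "nat \<Rightarrow> nat \<Rightarrow> mpoly \<Rightarrow> mpoly \<Rightarrow> mpoly" where
  "replace_power k n G F = (\<Sum>\<mu>\<in>Poly_Mapping.keys F.
     Poly_Mapping.single (Poly_Mapping.update k 0 \<mu>) (Poly_Mapping.lookup F \<mu>)
       * G ^ (Poly_Mapping.lookup \<mu> k div n))"

lemma update_0_add_single:
  fixes \<mu> :: monomial
  shows "Poly_Mapping.update k 0 \<mu> + Poly_Mapping.single k (Poly_Mapping.lookup \<mu> k) = \<mu>"
  by (rule poly_mapping_eqI) (simp add: lookup_add lookup_update lookup_single when_def)

lemma keys_update_0: "Poly_Mapping.keys (Poly_Mapping.update k 0 \<mu>) = Poly_Mapping.keys \<mu> - {k}"
  by (auto simp: in_keys_iff lookup_update split: if_splits)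

text \<open>Both polynomials agree term by term modulo \<open>Var k ^ n - G\<close>, because
  \<open>x - y\<close> divides \<open>x ^ a - y ^ a\<close>.\<close>

lemma dvd_diff_replace_power:
  assumes "\<And>\<mu>. \<mu> \<in> Poly_Mapping.keys F \<Longrightarrow> n dvd Poly_Mapping.lookup \<mu> k"
  shows "(Var k ^ n - G) dvd (F - replace_power k n G F)"
proof -
  let ?u = "\<lambda>\<mu>. Poly_Mapping.single (Poly_Mapping.update k 0 \<mu>) (Poly_Mapping.lookup F \<mu>)"
  let ?a = "\<lambda>\<mu>. Poly_Mapping.lookup \<mu> k div n"
  have "?u \<mu> * (Var k ^ n) ^ ?a \<mu> = Poly_Mapping.single \<mu> (Poly_Mapping.lookup F \<mu>)"
    if "\<mu> \<in> Poly_Mapping.keys F" for \<mu>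
    unfolding Var_power power_single
    using assms[OF that] by (simp add: mult_single update_0_add_single)
  then have "F = (\<Sum>\<mu>\<in>Poly_Mapping.keys F. ?u \<mu> * (Var k ^ n) ^ ?a \<mu>)"
    by (simp add: sum_single_keys)
  then have "F - replace_power k n G F
      = (\<Sum>\<mu>\<in>Poly_Mapping.keys F. ?u \<mu> * ((Var k ^ n) ^ ?a \<mu> - G ^ ?a \<mu>))"
    unfolding replace_power_def right_diff_distrib sum_subtractf by simp
  also have "(Var k ^ n - G) dvd \<dots>"
    by (intro dvd_sum dvd_mult diff_dvd_power_diff)
  finally show ?thesis .
qed

lemma replace_power_polys_in:
  assumes "F \<in> polys_in (Suc k)" "G \<in> polys_in k"
  shows "replace_power (Suc k) n G F \<in> polys_in k"
  unfolding replace_power_def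
proof (intro polys_in_sum polys_in_mult polys_in_power assms(2))
  fix \<mu> assume "\<mu> \<in> Poly_Mapping.keys F"
  with assms(1) have "Poly_Mapping.keys \<mu> \<subseteq> {..Suc k}" by (auto simp: polys_in_def)
  then show "Poly_Mapping.single (Poly_Mapping.update (Suc k) 0 \<mu>) (Poly_Mapping.lookup F \<mu>) \<in> polys_in k"
    by (auto simp: polys_in_def keys_update_0 le_Suc_eq)
qed

text \<open>After the substitution variable \<open>Suc k\<close> is gone, so the degree in it is 0
  and the congruence identifies the remainder.\<close>

lemma rem_in_eq_replace_power:
  assumes "n > 0" "F \<in> polys_in (Suc k)" "G \<in> polys_in k"
    and "\<And>\<mu>. \<mu> \<in> Poly_Mapping.keys F \<Longrightarrow> n dvd Poly_Mapping.lookup \<mu> (Suc k)"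
  shows "rem_in (Suc k) F (Var (Suc k) ^ n - G) = replace_power (Suc k) n G F"
proof (rule rem_in_eqI[OF assms(1)])
  have no_Suc: "Poly_Mapping.lookup \<nu> (Suc k) = 0"
    if "p \<in> polys_in k" "\<nu> \<in> Poly_Mapping.keys p" for p \<nu>
    using that by (force simp: polys_in_def in_keys_iff)
  show "Poly_Mapping.lookup \<nu> (Suc k) = 0" if "\<nu> \<in> Poly_Mapping.keys G" for \<nu>
    using no_Suc assms(3) that .
  have "degree_in (Suc k) (replace_power (Suc k) n G F) \<le> 0"
    using no_Suc[OF replace_power_polys_in[OF assms(2,3)]] by (intro degree_in_leI) simp
  then show "degree_in (Suc k) (replace_power (Suc k) n G F) < n"
    using assms(1) by simp
qed (use assms(4) in \<open>rule dvd_diff_replace_power\<close>)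

text \<open>As \<open>G\<close> weighs at most as much as the power it replaces, no term gains
  weight. The leading term keeps its weight and its uniqueness, for which \<open>G\<close> must have
  a unique leading monomial of full weight if \<open>k\<close> occurs in \<mu>.\<close>

lemma strict_leading_replace_power:
  assumes dvd: "\<And>\<mu>. \<mu> \<in> Poly_Mapping.keys F \<Longrightarrow> n dvd Poly_Mapping.lookup \<mu> k"
    and F: "strict_leading w F \<mu>"
    and G_le: "\<And>\<kappa>. \<kappa> \<in> Poly_Mapping.keys G \<Longrightarrow> monomial_weight w \<kappa> \<le> real n * w k"
    and G: "k \<in> Poly_Mapping.keys \<mu> \<Longrightarrow> strict_leading w G \<kappa> \<and> monomial_weight w \<kappa> = real n * w k"
  obtains \<nu> where "strict_leading w (replace_power k n G F) \<nu>"
    "monomial_weight w \<nu> = monomial_weight w \<mu>"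
    "\<And>i. i \<in> Poly_Mapping.keys \<nu> \<Longrightarrow>
       i \<in> Poly_Mapping.keys \<mu> \<or> k \<in> Poly_Mapping.keys \<mu> \<and> i \<in> Poly_Mapping.keys \<kappa>"
proof -
  let ?u = "\<lambda>\<mu>. Poly_Mapping.single (Poly_Mapping.update k 0 \<mu>) (Poly_Mapping.lookup F \<mu>)"
  let ?a = "\<lambda>\<mu>. Poly_Mapping.lookup \<mu> k div n"
  have wt: "monomial_weight w (Poly_Mapping.update k 0 \<nu>) + real (?a \<nu>) * (real n * w k)
      = monomial_weight w \<nu>" if "\<nu> \<in> Poly_Mapping.keys F" for \<nu>
  proof -
    have "real (?a \<nu>) * real n = real (Poly_Mapping.lookup \<nu> k)"
      using dvd[OF that] by (metis dvd_div_mult_self of_nat_mult)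
    then show ?thesis
      using monomial_weight_add[of w "Poly_Mapping.update k 0 \<nu>"
          "Poly_Mapping.single k (Poly_Mapping.lookup \<nu> k)"]
      by (simp add: update_0_add_single mult.assoc [symmetric])
  qed
  have \<mu>: "\<mu> \<in> Poly_Mapping.keys F" using F by (rule strict_leading_keys)
  obtain \<rho> where \<rho>: "strict_leading w (G ^ ?a \<mu>) \<rho>"
    "monomial_weight w \<rho> = real (?a \<mu>) * (real n * w k)"
    "\<And>i. i \<in> Poly_Mapping.keys \<rho> \<Longrightarrow> k \<in> Poly_Mapping.keys \<mu> \<and> i \<in> Poly_Mapping.keys \<kappa>"
  proof (cases "k \<in> Poly_Mapping.keys \<mu>")
    case True
    with G strict_leading_power[of w G \<kappa> "?a \<mu>"] that show thesis by (metis subsetD)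
  next
    case False
    then have "?a \<mu> = 0" by (simp add: in_keys_iff)
    \<comment> \<open>The power of \<open>G\<close> is 1 here, with leading monomial 0.\<close>
    with that[of 0] show thesis by (simp add: strict_leading_def)
  qed
  define \<nu> where "\<nu> = Poly_Mapping.update k 0 \<mu> + \<rho>"
  have \<nu>: "monomial_weight w \<nu> = monomial_weight w \<mu>"
    using wt[OF \<mu>] \<rho>(2) by (simp add: \<nu>_def monomial_weight_add)
  have "strict_leading w (replace_power k n G F) \<nu>"
    unfolding replace_power_def
  proof (rule strict_leading_sum[OF finite_keys \<mu>])
    show "strict_leading w (?u \<mu> * G ^ ?a \<mu>) \<nu>"
      unfolding \<nu>_def using \<mu> \<rho>(1)
      by (intro strict_leading_mult strict_leading_single) (simp_all add: in_keys_iff)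
  next
    fix \<mu>' \<nu>' assume \<mu>': "\<mu>' \<in> Poly_Mapping.keys F" "\<mu>' \<noteq> \<mu>"
      and "\<nu>' \<in> Poly_Mapping.keys (?u \<mu>' * G ^ ?a \<mu>')"
    then obtain b where b: "b \<in> Poly_Mapping.keys (G ^ ?a \<mu>')"
      "\<nu>' = Poly_Mapping.update k 0 \<mu>' + b"
      by (auto elim!: in_keys_multE split: if_splits)
    \<comment> \<open>For the other terms of \<open>F\<close> an upper bound is enough, since they
      start out strictly below \<mu>.\<close>
    have "monomial_weight w b \<le> real (?a \<mu>') * (real n * w k)"
      using G_le b(1) by (rule monomial_weight_power_le)
    then have "monomial_weight w \<nu>' \<le> monomial_weight w \<mu>'"
      using wt[OF \<mu>'(1)] by (simp add: b(2) monomial_weight_add)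
    also have "\<dots> < monomial_weight w \<mu>" using F \<mu>' by (rule strict_leading_less)
    finally show "monomial_weight w \<nu>' < monomial_weight w \<nu>" by (simp add: \<nu>)
  qed
  then show thesis
    using that[OF _ \<nu>] \<rho>(3) by (auto simp: \<nu>_def keys_add_nat keys_update_0)
qed

subsection \<open>Weights of the radicals\<close>

text \<open>Unfolds the recursion for the weights: the guard changes nothing on the variables of
  \<open>g i\<close>, and \<open>g i \<noteq> 0\<close> makes the degree finite.\<close>

lemma wdegree_weight:
  assumes "i \<ge> 1" "e i > 0" "g i \<in> polys_in (i - 1)" "g i \<noteq> 0"
  shows "wdeg e g (g i) = ereal (real (e i) * weight e g i)"
proof -
  let ?w = "\<lambda>j. if j < i then weight e g j else 0"
  have "monomial_weight ?w \<mu> = monomial_weight (weight e g) \<mu>" if "\<mu> \<in> Poly_Mapping.keys (g i)" for \<mu>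
    unfolding monomial_weight_def using assms(1,3) that
    by (intro sum.cong refl) (force simp: polys_in_def)
  then have "wdegree ?w (g i) = wdeg e g (g i)"
    by (simp add: wdegree_def cong: image_cong)
  moreover have "weight e g i = real_of_ereal (wdegree ?w (g i)) / real (e i)"
    using assms(1) by (subst weight.simps) simp
  ultimately show ?thesis using assms(2,4) by (auto simp: wdegree_def)
qed

section \<open>Leading monomials of polynomials that are not suspicious\<close>

lemma monomial_weight_le_wdegree:
  "\<mu> \<in> Poly_Mapping.keys p \<Longrightarrow> ereal (monomial_weight w \<mu>) \<le> wdegree w p"
  by (auto simp: wdegree_def)

text \<open>The first property negates the first rule for \<open>suspicious\<close>, the second
  property the other rule. The zero polynomial is excluded, having no leading monomial at
  all.\<close>

lemma not_suspiciousE: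
  assumes "\<not> suspicious e g f" "f \<noteq> 0"
  obtains \<mu> where "strict_leading (weight e g) f \<mu>"
    "\<And>i. i \<ge> 1 \<Longrightarrow> i \<in> Poly_Mapping.keys \<mu> \<Longrightarrow> \<not> suspicious e g (g i)"
proof -
  let ?L = "leading_monomials e g f" and ?w = "weight e g"
  have fin: "finite (Poly_Mapping.keys f)" "Poly_Mapping.keys f \<noteq> {}" using assms(2) by auto
  have "Max (monomial_weight ?w ` Poly_Mapping.keys f) \<in> monomial_weight ?w ` Poly_Mapping.keys f"
    using fin by (intro Max_in) auto
  then obtain \<mu> where "\<mu> \<in> Poly_Mapping.keys f"
    "Max (monomial_weight ?w ` Poly_Mapping.keys f) = monomial_weight ?w \<mu>"
    by blast
  then have \<mu>: "\<mu> \<in> ?L"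
    using assms(2) by (simp add: leading_monomials_def wdegree_def)
  have "finite ?L" by (simp add: leading_monomials_def)
  moreover have "card ?L < 2" using assms(1) several_leading_terms[of e g f] by force
  ultimately have L: "?L = {\<mu>}"
    using \<mu> by (metis One_nat_def card_1_singletonE card_gt_0_iff empty_iff less_2_cases less_numeral_extra(3)
        singletonD)
  show thesis
  proof (rule that)
    have "monomial_weight ?w \<nu> < monomial_weight ?w \<mu>"
      if "\<nu> \<in> Poly_Mapping.keys f" "\<nu> \<noteq> \<mu>" for \<nu>
    proof -
      have "\<nu> \<notin> ?L" using L that(2) by simp
      moreover have "wdeg e g f = ereal (monomial_weight ?w \<mu>)"
        using \<mu> by (simp add: leading_monomials_def)
      ultimately show ?thesis
        using that(1) monomial_weight_le_wdegree[of \<nu> f ?w] by (auto simp: leading_monomials_def)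
    qed
    then show "strict_leading ?w f \<mu>"
      using \<mu> by (simp add: strict_leading_def leading_monomials_def)
    show "\<not> suspicious e g (g i)" if "i \<ge> 1" "i \<in> Poly_Mapping.keys \<mu>" for i
      using suspicious_radicand[OF L that] assms(1) by blast
  qed
qed

section \<open>Elimination of the radicals\<close>

text \<open>The invariant of one elimination step. The new leading monomial may bring in variables
  of the leading monomial \<kappa> of \<open>g (Suc k)\<close>; their radicands are not suspicious
  because \<open>g (Suc k)\<close> itself is not.\<close>

lemma strict_leading_elimination:
  fixes e g k
  defines "w \<equiv> weight e g"
  assumes e: "e (Suc k) > 0" and g: "g (Suc k) \<in> polys_in k" "g (Suc k) \<noteq> 0"
    and p: "p \<in> polys_in (Suc k)" "strict_leading w p \<mu>"
    and ns: "\<And>i. i \<ge> 1 \<Longrightarrow> i \<in> Poly_Mapping.keys \<mu> \<Longrightarrow> \<not> suspicious e g (g i)"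
  obtains r \<nu> where
    "r = rem_in (Suc k) (conjugate_product e (Suc k) p) (E_poly e g (Suc k))"
    "r \<in> polys_in k" "strict_leading w r \<nu>"
    "monomial_weight w \<nu> = real (e (Suc k)) * monomial_weight w \<mu>"
    "\<And>i. i \<ge> 1 \<Longrightarrow> i \<in> Poly_Mapping.keys \<nu> \<Longrightarrow> \<not> suspicious e g (g i)"
proof -
  let ?F = "conjugate_product e (Suc k) p" and ?n = "e (Suc k)" and ?G = "g (Suc k)"
  have wG: "wdegree w ?G = ereal (real ?n * w (Suc k))"
    unfolding w_def using wdegree_weight[of "Suc k" e g] e g by simp
  have G_le: "monomial_weight w \<kappa> \<le> real ?n * w (Suc k)" if "\<kappa> \<in> Poly_Mapping.keys ?G" for \<kappa>
    using monomial_weight_le_wdegree[OF that, of w] wG by simp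
  have dvd: "?n dvd Poly_Mapping.lookup \<nu> (Suc k)" if "\<nu> \<in> Poly_Mapping.keys ?F" for \<nu>
    using dvd_lookup_conjugate_product[OF e that] .
  have F_in: "?F \<in> polys_in (Suc k)"
    unfolding conjugate_product_scale_var by (intro polys_in_prod polys_in_scale_var p(1))
  obtain \<mu>' where \<mu>': "strict_leading w ?F \<mu>'" "monomial_weight w \<mu>' = real ?n * monomial_weight w \<mu>"
    "Poly_Mapping.keys \<mu>' \<subseteq> Poly_Mapping.keys \<mu>"
  proof (rule strict_leading_prod[of "{1..?n}" w "\<lambda>j. scale_var (Suc k) (root_of_1 ?n ^ j) p" \<mu>])
    show "strict_leading w (scale_var (Suc k) (root_of_1 ?n ^ j) p) \<mu>" for j
      using p(2) by (rule strict_leading_scale_var) (simp add: root_of_1_nonzero)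
  qed (use that in \<open>simp_all add: conjugate_product_scale_var\<close>)
  \<comment> \<open>If \<open>Suc k\<close> does not occur in \<mu>', the condition is vacuous and
    any \<kappa> will do.\<close>
  obtain \<kappa> where \<kappa>: "Suc k \<in> Poly_Mapping.keys \<mu>' \<Longrightarrow>
      strict_leading w ?G \<kappa> \<and> monomial_weight w \<kappa> = real ?n * w (Suc k) \<and>
      (\<forall>i\<ge>1. i \<in> Poly_Mapping.keys \<kappa> \<longrightarrow> \<not> suspicious e g (g i))"
  proof (cases "Suc k \<in> Poly_Mapping.keys \<mu>'")
    case True
    with \<mu>'(3) have "\<not> suspicious e g ?G" by (intro ns) auto
    then obtain \<kappa> where "strict_leading w ?G \<kappa>"
      "\<And>i. i \<ge> 1 \<Longrightarrow> i \<in> Poly_Mapping.keys \<kappa> \<Longrightarrow> \<not> suspicious e g (g i)"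
      using g(2) unfolding w_def by (rule not_suspiciousE) blast
    with wG show thesis by (intro that[of \<kappa>]) (simp add: wdegree_strict_leading)
  qed (use that in blast)
  obtain \<nu> where \<nu>: "strict_leading w (replace_power (Suc k) ?n ?G ?F) \<nu>"
    "monomial_weight w \<nu> = monomial_weight w \<mu>'"
    "\<And>i. i \<in> Poly_Mapping.keys \<nu> \<Longrightarrow>
       i \<in> Poly_Mapping.keys \<mu>' \<or> Suc k \<in> Poly_Mapping.keys \<mu>' \<and> i \<in> Poly_Mapping.keys \<kappa>"
    using strict_leading_replace_power[where \<kappa> = \<kappa>, OF dvd \<mu>'(1) G_le] \<kappa> by blast
  show thesis
  proof (rule that)
    show "replace_power (Suc k) ?n ?G ?F = rem_in (Suc k) ?F (E_poly e g (Suc k))"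
      unfolding E_poly_def using rem_in_eq_replace_power[OF e F_in g(1) dvd] by simp
    show "replace_power (Suc k) ?n ?G ?F \<in> polys_in k"
      using F_in g(1) by (rule replace_power_polys_in)
    show "\<not> suspicious e g (g i)" if "i \<ge> 1" "i \<in> Poly_Mapping.keys \<nu>" for i
      using \<nu>(3)[OF that(2)] \<mu>'(3) ns \<kappa> that(1) by blast
  qed (use \<nu> \<mu>' in simp_all)
qed

text \<open>Induction over the eliminations, with \<open>p\<close> and \<mu> general, since the
  remainder and its leading monomial take their place. Each step multiplies the weight by one more
  \<open>e i\<close>.\<close>

lemma strict_leading_R_poly:
  fixes e g
  defines "w \<equiv> weight e g"
  assumes "\<And>i. i \<in> {1..m} \<Longrightarrow> e i > 0"
    and "\<And>i. i \<in> {1..m} \<Longrightarrow> g i \<in> polys_in (i - 1)"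
    and "\<And>i. i \<in> {1..m} \<Longrightarrow> g i \<noteq> 0"
    and "p \<in> polys_in m" "strict_leading w p \<mu>"
    and "\<And>i. i \<ge> 1 \<Longrightarrow> i \<in> Poly_Mapping.keys \<mu> \<Longrightarrow> \<not> suspicious e g (g i)"
  obtains \<nu> where "strict_leading w (R_poly e g m p) \<nu>"
    "monomial_weight w \<nu> = monomial_weight w \<mu> * real (\<Prod>i=1..m. e i)"
proof -
  have "\<exists>\<nu>. strict_leading w (R_poly e g m p) \<nu> \<and>
    monomial_weight w \<nu> = monomial_weight w \<mu> * real (\<Prod>i=1..m. e i)"
    using assms(2-)
  proof (induction m arbitrary: p \<mu>)
    case 0
    then show ?case by auto
  next
    case (Suc k)
    obtain r \<rho> where r:
      "r = rem_in (Suc k) (conjugate_product e (Suc k) p) (E_poly e g (Suc k))"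
      "r \<in> polys_in k" "strict_leading w r \<rho>"
      "monomial_weight w \<rho> = real (e (Suc k)) * monomial_weight w \<mu>"
      "\<And>i. i \<ge> 1 \<Longrightarrow> i \<in> Poly_Mapping.keys \<rho> \<Longrightarrow> \<not> suspicious e g (g i)"
      using strict_leading_elimination[of e k g p \<mu>] Suc.prems(1,2,3)[of "Suc k"] Suc.prems(4-6)
      unfolding w_def by auto
    obtain \<nu> where "strict_leading w (R_poly e g k r) \<nu>"
      "monomial_weight w \<nu> = monomial_weight w \<rho> * real (\<Prod>i=1..k. e i)"
      using Suc.IH[of r \<rho>] Suc.prems(1-3) r(2,3,5) by auto
    then show ?case using r(1,4) by (auto simp: algebra_simps)
  qed
  then show thesis using that by blast
qed

theorem theorem4p12:
  fixes m :: nat and e :: "nat \<Rightarrow> nat" and g :: "nat \<Rightarrow> mpoly" and f :: mpoly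
  assumes "\<And>i. i \<in> {1..m} \<Longrightarrow> e i > 0"
    and "\<And>i. i \<in> {1..m} \<Longrightarrow> g i \<in> polys_in (i - 1)"
    and "\<And>i. i \<in> {1..m} \<Longrightarrow> g i \<noteq> 0"
    and "\<And>i j. i \<in> {1..m} \<Longrightarrow> j \<in> {1..<i} \<Longrightarrow> degree_in j (g i) < e j"
    and "f \<in> polys_in m"
    and "\<not> suspicious e g f"
  shows "\<not> guilty e g m f"
proof (cases "f = 0")
  case True
  \<comment> \<open>Positivity matters, because minus infinity times 0 would be 0.\<close>
  have "real (\<Prod>i=1..m. e i) > 0" using assms(1) by (subst of_nat_0_less_iff, intro prod_pos) auto
  moreover have "wdeg e g f = -\<infinity>" using True by (simp add: wdegree_def)
  ultimately have "wdeg e g f * ereal (real (\<Prod>i=1..m. e i)) = -\<infinity>"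
    by (simp only: times_ereal.simps if_True less_imp_neq [symmetric] if_False)
  then show ?thesis unfolding guilty_def by (simp only: not_less ereal_less_eq)
next
  case False
  obtain \<mu> where \<mu>: "strict_leading (weight e g) f \<mu>"
    "\<And>i. i \<ge> 1 \<Longrightarrow> i \<in> Poly_Mapping.keys \<mu> \<Longrightarrow> \<not> suspicious e g (g i)"
    using not_suspiciousE[OF assms(6) False] by blast
  obtain \<nu> where "strict_leading (weight e g) (R_poly e g m f) \<nu>"
    "monomial_weight (weight e g) \<nu> = monomial_weight (weight e g) \<mu> * real (\<Prod>i=1..m. e i)"
    using strict_leading_R_poly[OF assms(1-3,5) \<mu>] by blast
  \<comment> \<open>Both sides of the inequality that defines \<open>guilty\<close> are equal, so it
    fails.\<close>
  with \<mu>(1) show ?thesis by (simp add: guilty_def wdegree_strict_leading del: of_nat_prod)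
qed

end
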